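(* Let $0<\alpha<\tfrac12$, $0<\tau<1$ and $\xi\in\mathbb{R}$, and define $$T_s:=\frac{\sin\pi(1-\tau+\alpha-i\xi)}{\sin\pi(1-\tau+2\alpha-i\xi)},\qquad T_B:=\frac{\sin\pi\alpha}{\pi}\,B(\tau-2\alpha+1+i\xi,2\alpha).$$ (a) If $\xi=0$ and $0<\tau<1$, then $T_s\ne T_B$. (b) If $\xi\ge\tfrac14$ and $\alpha\le\tau<1$, then $|T_s|>|T_B|$. (c) If $0<\xi<\tfrac14$ and $\alpha\le\tau<1$, then $\arg T_s<\arg T_B$. (d) If $\xi>0$ and $0<\tau<\alpha$, then $\arg T_s\ne\arg T_B$. Consequently, the equation $T_s=T_B$ has no solutions with $0<\alpha<\tfrac12$, $0<\tau<1$, $\xi\in\mathbb{R}$.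
   Context: $B(a,b)=\Gamma(a)\Gamma(b)/\Gamma(a+b)$ is the Beta function extended to complex arguments. $\arg$ denotes the principal argument, with values in $(-\pi,\pi]$. *)

theory Defs
  imports "HOL-Analysis.Analysis"
begin

definition T_s :: "real \<Rightarrow> real \<Rightarrow> real \<Rightarrow> complex" where
  "T_s \<alpha> \<tau> \<xi> =
     sin (of_real pi * (of_real (1 - \<tau> + \<alpha>) - \<i> * of_real \<xi>)) /
     sin (of_real pi * (of_real (1 - \<tau> + 2 * \<alpha>) - \<i> * of_real \<xi>))"

definition T_B :: "real \<Rightarrow> real \<Rightarrow> real \<Rightarrow> complex" where
  "T_B \<alpha> \<tau> \<xi> =
     of_real (sin (pi * \<alpha>) / pi) *
     Beta (of_real (\<tau> - 2 * \<alpha> + 1) + \<i> * of_real \<xi>) (of_real (2 * \<alpha>))"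

end

theory Submission
  imports Defs
begin

text \<open>
  For \<open>\<xi> > 0\<close> the strict inequality \<open>Arg T_s < Arg T_B\<close> holds on the whole range \<open>0 < \<tau> < 1\<close>, which gives
  (c) and (d) at once. By the reflection formula both arguments are combinations of
  \<open>H(t) = Im log \<Gamma>(t + i\<xi>)\<close>. Fixing \<open>u = \<tau> - \<alpha>\<close> and regarding their difference as a function of \<open>\<alpha>\<close>, it
  vanishes at \<open>\<alpha> = 0\<close> and has derivative \<open>F(1 + u + \<alpha>) - F(\<alpha> - u)\<close>, where
  \<open>F(t) = H'(t) = \<Sum>n. \<xi> / ((t + n)\<^sup>2 + \<xi>\<^sup>2)\<close>. This is negative, term by term, because
  \<open>\<bar>\<alpha> - u\<bar> < 1 + u + \<alpha>\<close>.

  For (b), \<open>|T_B| \<le> 2/\<pi> < tanh (\<pi>/4) \<le> tanh (\<pi>\<xi>) \<le> |T_s|\<close>, where \<open>|T_B|\<close> is bounded by its value at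
  \<open>\<xi> = 0\<close>, \<open>\<tau> = \<alpha>\<close>, which increases to \<open>2/\<pi>\<close> at \<open>\<alpha> = 1/2\<close>. For (a), the two real numbers either
  have different signs (\<open>\<alpha> \<le> \<tau> \<le> 2\<alpha>\<close>), or are separated by \<open>1/2\<close> (\<open>2\<alpha> < \<tau>\<close>), or their quotient is
  monotone in \<open>\<tau>\<close> by the strict concavity of \<open>ln (\<Gamma>(x + \<alpha>) / \<Gamma>(x))\<close> (\<open>\<tau> < \<alpha>\<close>).
\<close>

section \<open>Arguments of complex numbers\<close>

lemma is_Arg_of_real: "0 \<le> r \<Longrightarrow> is_Arg (of_real r) 0"
  by (simp add: is_Arg_def)

lemma is_Arg_cnj:
  assumes "is_Arg z t"
  shows "is_Arg (cnj z) (- t)"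
proof -
  have "cnj z = cnj (of_real (cmod z) * exp (\<i> * of_real t))"
    using assms by (simp add: is_Arg_def)
  also have "\<dots> = of_real (cmod (cnj z)) * exp (\<i> * of_real (- t))"
    by (simp add: exp_cnj)
  finally show ?thesis unfolding is_Arg_def .
qed

lemma is_Arg_mult:
  assumes "is_Arg z s" "is_Arg w t"
  shows "is_Arg (z * w) (s + t)"
proof -
  have "z * w = (of_real (cmod z) * exp (\<i> * of_real s)) * (of_real (cmod w) * exp (\<i> * of_real t))"
    using assms unfolding is_Arg_def by metis
  also have "\<dots> = of_real (cmod (z * w)) * exp (\<i> * of_real (s + t))"
    by (simp add: norm_mult distrib_left exp_add)
  finally show ?thesis unfolding is_Arg_def .
qed

lemma is_Arg_divide:
  assumes "is_Arg z s" "is_Arg w t"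
  shows "is_Arg (z / w) (s - t)"
proof -
  have "z / w = (of_real (cmod z) * exp (\<i> * of_real s)) / (of_real (cmod w) * exp (\<i> * of_real t))"
    using assms unfolding is_Arg_def by metis
  also have "\<dots> = of_real (cmod (z / w)) * exp (\<i> * of_real (s - t))"
    by (simp add: norm_divide right_diff_distrib exp_diff)
  finally show ?thesis unfolding is_Arg_def .
qed

lemma is_Arg_imp_Im_eq:
  assumes "is_Arg z t"
  shows "Im z = cmod z * sin t"
proof -
  have "Im z = Im (of_real (cmod z) * exp (\<i> * of_real t))"
    using assms by (simp add: is_Arg_def)
  also have "\<dots> = cmod z * sin t"
    by (simp add: Im_exp)
  finally show ?thesis .
qed

lemma is_Arg_imp_Arg_eq:
  assumes "is_Arg z t" "z \<noteq> 0" "- pi < t" "t \<le> pi"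
  shows "Arg z = t"
  using Arg_unique_lemma[OF assms(1) is_Arg_Arg] assms mpi_less_Arg Arg_le_pi by blast

section \<open>The complex sine on horizontal lines\<close>

lemma Re_sin_cosh: "Re (sin z) = sin (Re z) * cosh (Im z)"
  and Im_sin_sinh: "Im (sin z) = cos (Re z) * sinh (Im z)"
  by (simp_all add: Re_sin Im_sin cosh_field_def sinh_field_def)

lemma cmod_sin_squared_sinh: "(cmod (sin z))\<^sup>2 = (sin (Re z))\<^sup>2 + (sinh (Im z))\<^sup>2"
  by (simp add: cmod_power2 Re_sin_cosh Im_sin_sinh power_mult_distrib cosh_square_eq cos_squared_eq)
    (simp add: algebra_simps)

lemma abs_sinh_Im_le_cmod_sin: "\<bar>sinh (Im z)\<bar> \<le> cmod (sin z)"
  by (rule power2_le_imp_le) (simp_all add: cmod_sin_squared_sinh)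

lemma cmod_sin_le_cosh_Im: "cmod (sin z) \<le> cosh (Im z)"
proof (rule power2_le_imp_le)
  show "(cmod (sin z))\<^sup>2 \<le> (cosh (Im z))\<^sup>2"
    by (simp add: cmod_sin_squared_sinh cosh_square_eq abs_square_le_1)
qed simp

lemma abs_tanh_le_cmod_sin_divide_sin:
  assumes "Im z = Im w"
  shows "\<bar>tanh (Im w)\<bar> \<le> cmod (sin z / sin w)"
proof (cases "sin w = 0")
  case True
  hence "sinh (Im w) = 0" using abs_sinh_Im_le_cmod_sin[of w] by simp
  thus ?thesis using True by simp
next
  case False
  have "\<bar>tanh (Im w)\<bar> = \<bar>sinh (Im w)\<bar> / cosh (Im w)"
    by (simp add: tanh_def)
  also have "\<dots> \<le> cmod (sin z) / cmod (sin w)"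
    using False abs_sinh_Im_le_cmod_sin[of z] cmod_sin_le_cosh_Im[of w] assms
    by (intro frac_le) simp_all
  finally show ?thesis by (simp add: norm_divide)
qed

lemma Im_sin_divide_sin:
  assumes "Im z = Im w"
  shows "Im (sin z / sin w) =
           - (sinh (Im w) * cosh (Im w) * sin (Re z - Re w)) / (cmod (sin w))\<^sup>2"
proof -
  have "Im (sin z) * Re (sin w) - Re (sin z) * Im (sin w) =
          - (sinh (Im w) * cosh (Im w) * sin (Re z - Re w))"
    by (simp add: Re_sin_cosh Im_sin_sinh assms sin_diff algebra_simps)
  thus ?thesis by (simp add: Im_divide cmod_power2)
qed

section \<open>The real Gamma and Beta functions\<close>

lemma Gamma_real_neq_0: "0 < x \<Longrightarrow> Gamma x \<noteq> 0" for x :: real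
  by (metis Gamma_real_pos less_irrefl)

lemma Gamma_plus1_pos: "0 < x \<Longrightarrow> Gamma (1 + x) = x * Gamma x" for x :: real
  using Gamma_plus1[of x] by (force simp: add.commute)

lemma Beta_1_left: "0 < b \<Longrightarrow> Beta 1 b = 1 / b" for b :: real
  by (simp add: Beta_def Gamma_plus1_pos Gamma_real_neq_0)

lemma Beta_real_pos: "0 < a \<Longrightarrow> 0 < b \<Longrightarrow> 0 < Beta a b" for a b :: real
  by (simp add: Beta_def)

lemma sin_pi_div_pi_conv_Gamma: "sin (pi * x) / pi = 1 / (Gamma x * Gamma (1 - x))" for x :: real
proof -
  have "complex_of_real (Gamma x * Gamma (1 - x)) = of_real (pi / sin (pi * x))"
    using Gamma_reflection_complex[of "of_real x"] Gamma_complex_of_real[of "1 - x"]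
    by (simp add: Gamma_complex_of_real sin_of_real[symmetric])
  hence "Gamma x * Gamma (1 - x) = pi / sin (pi * x)" by (simp only: of_real_eq_iff)
  thus ?thesis by simp
qed

lemma Digamma_diff_strict_antimono:
  fixes c x y :: real
  assumes "0 < c" "0 < x" "x < y"
  shows "Digamma (y + c) - Digamma y < Digamma (x + c) - Digamma x"
proof (rule DERIV_neg_imp_decreasing[of x y "\<lambda>t. Digamma (t + c) - Digamma t"])
  fix t assume t: "x \<le> t" "t \<le> y"
  have "((\<lambda>t. Digamma (t + c) - Digamma t) has_field_derivative
          (Polygamma 1 (t + c) - Polygamma 1 t)) (at t)"
    using assms t by (auto intro!: derivative_eq_intros elim!: nonpos_Ints_cases)
  moreover have "Polygamma 1 (t + c) < Polygamma 1 t"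
    using assms t by (intro Polygamma_real_strict_antimono) auto
  ultimately show "\<exists>d. ((\<lambda>t. Digamma (t + c) - Digamma t) has_real_derivative d) (at t) \<and> d < 0"
    by force
qed fact

text \<open>The logarithm of \<open>\<Gamma>(x + c) / \<Gamma>(x)\<close> is strictly concave in \<open>x\<close>.\<close>

lemma Gamma_shift_quotients_spread_less:
  fixes c t x y :: real
  assumes "0 < c" "0 < t" "t < x" "x \<le> y"
  shows "Gamma (x - t + c) / Gamma (x - t) * (Gamma (y + t + c) / Gamma (y + t))
           < Gamma (x + c) / Gamma x * (Gamma (y + c) / Gamma y)"
proof -
  define f where
    "f s = ln_Gamma (x - s + c) - ln_Gamma (x - s) + (ln_Gamma (y + s + c) - ln_Gamma (y + s))" for s
  have deriv: "(f has_field_derivative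
      (Digamma (y + s + c) - Digamma (y + s)) - (Digamma (x - s + c) - Digamma (x - s))) (at s)"
    if "0 \<le> s" "s \<le> t" for s
    unfolding f_def using assms that by (auto intro!: derivative_eq_intros)
  have "f t < f 0"
  proof (rule DERIV_neg_imp_decreasing_open[OF \<open>0 < t\<close>])
    fix s assume s: "0 < s" "s < t"
    have "Digamma (y + s + c) - Digamma (y + s) < Digamma (x - s + c) - Digamma (x - s)"
      using assms s by (intro Digamma_diff_strict_antimono) auto
    with deriv[of s] s show "\<exists>d. (f has_real_derivative d) (at s) \<and> d < 0" by force
  next
    show "continuous_on {0..t} f"
      using deriv by (intro DERIV_atLeastAtMost_imp_continuous_on) auto
  qed
  hence "exp (f t) < exp (f 0)" by simp
  thus ?thesis
    using assms by (simp add: f_def exp_diff exp_add flip: Gamma_real_pos_exp)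
qed

lemma Gamma_double_quotient_mono:
  fixes a b :: real
  assumes "0 \<le> a" "a \<le> b"
  shows "Gamma (1 + 2 * a) / (Gamma (1 + a))\<^sup>2 \<le> Gamma (1 + 2 * b) / (Gamma (1 + b))\<^sup>2"
proof -
  define f where "f x = ln_Gamma (1 + 2 * x) - 2 * ln_Gamma (1 + x)" for x :: real
  have "f a \<le> f b"
  proof (rule DERIV_nonneg_imp_nondecreasing[OF \<open>a \<le> b\<close>])
    fix x assume x: "a \<le> x" "x \<le> b"
    have "(f has_field_derivative (2 * Digamma (1 + 2 * x) - 2 * Digamma (1 + x))) (at x)"
      unfolding f_def using assms x by (auto intro!: derivative_eq_intros)
    moreover have "Digamma (1 + x) \<le> Digamma (1 + 2 * x)"
      using assms x by (intro Digamma_real_mono) auto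
    ultimately show "\<exists>d. (f has_real_derivative d) (at x) \<and> 0 \<le> d" by fastforce
  qed
  moreover have "exp (f x) = Gamma (1 + 2 * x) / (Gamma (1 + x))\<^sup>2" if "0 \<le> x" for x
    using that by (simp add: f_def exp_diff Gamma_real_pos_exp exp_double)
  ultimately show ?thesis using assms by (metis exp_le_cancel_iff order_trans)
qed

section \<open>The modulus of the complex Beta function\<close>

lemma Re_over_cmod_mono:
  assumes "0 < Re z" "0 \<le> b"
  shows "Re z / cmod z \<le> (Re z + b) / cmod (z + of_real b)"
proof -
  have "Re z * cmod (z + of_real b) \<le> (Re z + b) * cmod z"
  proof (rule power2_le_imp_le)
    have "(Re z)\<^sup>2 * (Im z)\<^sup>2 \<le> (Re z + b)\<^sup>2 * (Im z)\<^sup>2"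
      using assms by (intro mult_right_mono power_mono) auto
    thus "(Re z * cmod (z + of_real b))\<^sup>2 \<le> ((Re z + b) * cmod z)\<^sup>2"
      by (simp only: power_mult_distrib cmod_power2) (simp add: algebra_simps)
  qed (use assms in simp)
  moreover have "z \<noteq> 0" "z + of_real b \<noteq> 0"
    using assms by (auto simp: complex_eq_iff)
  ultimately show ?thesis by (simp add: field_simps)
qed

lemma cmod_Gamma_series_over_Gamma_series_Re:
  "cmod (Gamma_series z n) / Gamma_series (Re z) n = (\<Prod>k=0..n. Re (z + of_nat k) / cmod (z + of_nat k))"
  by (simp add: Gamma_series_def norm_divide norm_mult pochhammer_Suc_prod prod_norm prod_dividef)

lemma cmod_Gamma_over_Gamma_Re_mono:
  assumes "0 < Re z" "0 \<le> b"
  shows "cmod (Gamma z) / Gamma (Re z) \<le> cmod (Gamma (z + of_real b)) / Gamma (Re z + b)"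
proof (rule LIMSEQ_le)
  show "(\<lambda>n. cmod (Gamma_series z n) / Gamma_series (Re z) n)
          \<longlonglongrightarrow> cmod (Gamma z) / Gamma (Re z)"
    using assms by (intro tendsto_intros Gamma_real_neq_0)
  show "(\<lambda>n. cmod (Gamma_series (z + of_real b) n) / Gamma_series (Re z + b) n)
          \<longlonglongrightarrow> cmod (Gamma (z + of_real b)) / Gamma (Re z + b)"
    using assms by (intro tendsto_intros Gamma_real_neq_0) simp
  have "cmod (Gamma_series z n) / Gamma_series (Re z) n
          \<le> cmod (Gamma_series (z + of_real b) n) / Gamma_series (Re z + b) n" for n
  proof -
    have "(\<Prod>k=0..n. Re (z + of_nat k) / cmod (z + of_nat k))
            \<le> (\<Prod>k=0..n. Re (z + of_real b + of_nat k) / cmod (z + of_real b + of_nat k))"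
    proof (rule prod_mono)
      fix k
      show "0 \<le> Re (z + of_nat k) / cmod (z + of_nat k) \<and>
          Re (z + of_nat k) / cmod (z + of_nat k)
            \<le> Re (z + of_real b + of_nat k) / cmod (z + of_real b + of_nat k)"
        using assms Re_over_cmod_mono[of "z + of_nat k" b] by (simp add: add_ac)
    qed
    thus ?thesis
      using cmod_Gamma_series_over_Gamma_series_Re[of z n]
            cmod_Gamma_series_over_Gamma_series_Re[of "z + of_real b" n]
      by simp
  qed
  thus "\<exists>N. \<forall>n\<ge>N. cmod (Gamma_series z n) / Gamma_series (Re z) n
          \<le> cmod (Gamma_series (z + of_real b) n) / Gamma_series (Re z + b) n"
    by blast
qed

lemma cmod_Beta_le:
  assumes "0 < Re z" "0 < b"
  shows "cmod (Beta z (of_real b)) \<le> Beta (Re z) b"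
proof -
  have "z + of_real b \<notin> \<int>\<^sub>\<le>\<^sub>0"
    using assms by (auto elim!: nonpos_Ints_cases simp: complex_eq_iff)
  hence "0 < cmod (Gamma (z + of_real b))" by (simp add: Gamma_eq_zero_iff)
  hence "cmod (Gamma z) / cmod (Gamma (z + of_real b)) \<le> Gamma (Re z) / Gamma (Re z + b)"
    using cmod_Gamma_over_Gamma_Re_mono[of z b] assms by (simp add: field_simps)
  hence "Gamma b * (cmod (Gamma z) / cmod (Gamma (z + of_real b)))
          \<le> Gamma b * (Gamma (Re z) / Gamma (Re z + b))"
    using assms by (intro mult_left_mono) auto
  thus ?thesis
    using assms by (simp add: Beta_def norm_mult norm_divide Gamma_complex_of_real mult_ac)
qed

section \<open>The argument of the Gamma function along a horizontal line\<close>

definition arg_Gamma :: "real \<Rightarrow> real \<Rightarrow> real" where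
  "arg_Gamma \<xi> t = Im (ln_Gamma (Complex t \<xi>))"

definition Im_Digamma :: "real \<Rightarrow> real \<Rightarrow> real" where
  "Im_Digamma \<xi> t = Im (Digamma (Complex t \<xi>))"

lemma Complex_not_nonpos_Reals: "\<xi> \<noteq> 0 \<Longrightarrow> Complex t \<xi> \<notin> \<real>\<^sub>\<le>\<^sub>0"
  by (simp add: complex_nonpos_Reals_iff)

lemma Complex_not_nonpos_Ints: "\<xi> \<noteq> 0 \<Longrightarrow> Complex t \<xi> \<notin> \<int>\<^sub>\<le>\<^sub>0"
  using Complex_not_nonpos_Reals nonpos_Ints_subset_nonpos_Reals by blast

lemma has_field_derivative_arg_Gamma:
  assumes "\<xi> \<noteq> 0"
  shows "(arg_Gamma \<xi> has_field_derivative Im_Digamma \<xi> t) (at t)"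
proof -
  have "((\<lambda>t. of_real t + \<i> * of_real \<xi>) has_vector_derivative 1) (at t)"
    by (auto intro!: derivative_eq_intros)
  hence "((\<lambda>t. Complex t \<xi>) has_vector_derivative 1) (at t)"
    by (simp add: Complex_eq)
  hence "((ln_Gamma \<circ> (\<lambda>t. Complex t \<xi>)) has_vector_derivative (1 * Digamma (Complex t \<xi>))) (at t)"
    by (rule field_vector_diff_chain_at)
       (rule has_field_derivative_ln_Gamma_complex[OF Complex_not_nonpos_Reals[OF assms]])
  hence "((\<lambda>t. Im (ln_Gamma (Complex t \<xi>))) has_vector_derivative Im (Digamma (Complex t \<xi>))) (at t)"
    using bounded_linear.has_vector_derivative[OF bounded_linear_Im] by (auto simp: o_def)
  thus ?thesis
    by (simp add: arg_Gamma_def[abs_def] Im_Digamma_def has_real_derivative_iff_has_vector_derivative)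
qed

lemma continuous_on_arg_Gamma: "\<xi> \<noteq> 0 \<Longrightarrow> continuous_on A (arg_Gamma \<xi>)"
  by (meson DERIV_isCont continuous_at_imp_continuous_on has_field_derivative_arg_Gamma)

lemma Im_Digamma_sums:
  assumes "\<xi> \<noteq> 0"
  shows "(\<lambda>n. \<xi> / ((t + real n)\<^sup>2 + \<xi>\<^sup>2)) sums Im_Digamma \<xi> t"
proof -
  let ?z = "Complex t \<xi>"
  have "?z \<noteq> 0" using assms by (simp add: complex_eq_iff)
  hence "(\<lambda>n. inverse (of_nat (Suc n)) - inverse (?z + of_nat n)) sums (Digamma ?z + euler_mascheroni)"
    using summable_sums[OF summable_Digamma] by (simp add: Digamma_def)
  hence "(\<lambda>n. Im (inverse (of_nat (Suc n)) - inverse (?z + of_nat n))) sums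
           Im (Digamma ?z + euler_mascheroni)"
    by (rule sums_Im)
  moreover have "Im (inverse (of_nat (Suc n)) - inverse (?z + of_nat n)) =
                   \<xi> / ((t + real n)\<^sup>2 + \<xi>\<^sup>2)" for n
  proof -
    have "Im (inverse (complex_of_real (real (Suc n)))) = 0"
      by (simp only: of_real_inverse[symmetric] Im_complex_of_real)
    thus ?thesis by simp
  qed
  moreover have "Im (euler_mascheroni :: complex) = 0"
    by (metis Im_complex_of_real of_real_euler_mascheroni)
  ultimately show ?thesis by (simp add: Im_Digamma_def)
qed

lemma Im_Digamma_plus1:
  assumes "\<xi> \<noteq> 0"
  shows "Im_Digamma \<xi> t = \<xi> / (t\<^sup>2 + \<xi>\<^sup>2) + Im_Digamma \<xi> (t + 1)"
proof -
  have "(\<lambda>n. \<xi> / ((t + real (Suc n))\<^sup>2 + \<xi>\<^sup>2)) sums Im_Digamma \<xi> (t + 1)"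
    using Im_Digamma_sums[OF assms, of "t + 1"] by (simp add: add_ac)
  from sums_Suc[OF this] Im_Digamma_sums[OF assms, of t] show ?thesis
    by (simp add: sums_iff)
qed

lemma Im_Digamma_pos:
  assumes "0 < \<xi>"
  shows "0 < Im_Digamma \<xi> t"
proof -
  have "0 < (\<Sum>n. \<xi> / ((t + real n)\<^sup>2 + \<xi>\<^sup>2))"
    using assms Im_Digamma_sums[of \<xi> t]
    by (intro suminf_pos) (auto simp: sums_iff add_nonneg_pos)
  thus ?thesis using assms Im_Digamma_sums[of \<xi> t] by (simp add: sums_iff)
qed

lemma Im_Digamma_less:
  assumes "0 < \<xi>" "\<bar>s\<bar> < t"
  shows "Im_Digamma \<xi> t < Im_Digamma \<xi> s"
proof -
  have "\<bar>s + real n\<bar> < \<bar>t + real n\<bar>" for n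
    using assms by linarith
  hence "(s + real n)\<^sup>2 < (t + real n)\<^sup>2" for n
    by (rule power2_strict_mono)
  hence less: "\<xi> / ((t + real n)\<^sup>2 + \<xi>\<^sup>2) < \<xi> / ((s + real n)\<^sup>2 + \<xi>\<^sup>2)" for n
    using assms by (intro divide_strict_left_mono) (auto simp: add_nonneg_pos)
  have "(\<lambda>n. \<xi> / ((s + real n)\<^sup>2 + \<xi>\<^sup>2) - \<xi> / ((t + real n)\<^sup>2 + \<xi>\<^sup>2)) sums
          (Im_Digamma \<xi> s - Im_Digamma \<xi> t)"
    using assms by (intro sums_diff Im_Digamma_sums) auto
  moreover from this
  have "0 < (\<Sum>n. \<xi> / ((s + real n)\<^sup>2 + \<xi>\<^sup>2) - \<xi> / ((t + real n)\<^sup>2 + \<xi>\<^sup>2))"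
    using less by (intro suminf_pos) (auto simp: sums_iff)
  ultimately show ?thesis by (simp add: sums_iff)
qed

lemma is_Arg_Gamma: "\<xi> \<noteq> 0 \<Longrightarrow> is_Arg (Gamma (Complex t \<xi>)) (arg_Gamma \<xi> t)"
  by (simp add: Gamma_complex_altdef Complex_not_nonpos_Ints arg_Gamma_def is_Arg_exp_Im)

definition arg_sin_pi :: "real \<Rightarrow> real \<Rightarrow> real" where
  "arg_sin_pi \<xi> t = arg_Gamma \<xi> (1 - t) - arg_Gamma \<xi> t"

lemma is_Arg_sin_pi:
  assumes "\<xi> \<noteq> 0"
  shows "is_Arg (sin (of_real pi * Complex t \<xi>)) (arg_sin_pi \<xi> t)"
proof -
  have "1 - Complex t \<xi> = cnj (Complex (1 - t) \<xi>)"
    by (simp add: complex_eq_iff)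
  hence "sin (of_real pi * Complex t \<xi>) =
      of_real pi / (Gamma (Complex t \<xi>) * cnj (Gamma (Complex (1 - t) \<xi>)))"
    using Gamma_reflection_complex[of "Complex t \<xi>"] by (simp add: cnj_Gamma)
  moreover have "is_Arg \<dots> (0 - (arg_Gamma \<xi> t + - arg_Gamma \<xi> (1 - t)))"
    by (intro is_Arg_divide is_Arg_mult is_Arg_cnj is_Arg_of_real is_Arg_Gamma assms) simp
  ultimately show ?thesis by (simp add: arg_sin_pi_def)
qed

section \<open>Comparison of arguments\<close>

lemma T_s_altdef:
  "T_s \<alpha> \<tau> \<xi> = sin (of_real pi * Complex (\<tau> - \<alpha>) \<xi>) / sin (of_real pi * Complex (\<tau> - 2 * \<alpha>) \<xi>)"
proof -
  have "sin (of_real pi * (of_real (1 - t) - \<i> * of_real \<xi>)) = sin (of_real pi * Complex t \<xi>)" for t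
  proof -
    have "of_real pi * (of_real (1 - t) - \<i> * of_real \<xi>) = of_real pi - of_real pi * Complex t \<xi>"
      by (simp add: Complex_eq algebra_simps)
    thus ?thesis by (simp add: sin_diff)
  qed
  from this[of "\<tau> - \<alpha>"] this[of "\<tau> - 2 * \<alpha>"] show ?thesis
    unfolding T_s_def by (simp add: algebra_simps)
qed

lemma T_B_altdef:
  "T_B \<alpha> \<tau> \<xi> = of_real (sin (pi * \<alpha>) / pi) * Beta (Complex (1 + \<tau> - 2 * \<alpha>) \<xi>) (of_real (2 * \<alpha>))"
proof -
  have "of_real (\<tau> - 2 * \<alpha> + 1) + \<i> * of_real \<xi> = Complex (1 + \<tau> - 2 * \<alpha>) \<xi>"
    by (simp add: complex_eq_iff)
  thus ?thesis unfolding T_B_def by (simp only:)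
qed

text \<open>
  Continuous branches of the arguments of \<open>T_s\<close> and \<open>T_B\<close>; with \<open>\<tau> - \<alpha>\<close> held fixed, both
  vanish at \<open>\<alpha> = 0\<close>.
\<close>

definition arg_T_s :: "real \<Rightarrow> real \<Rightarrow> real \<Rightarrow> real" where
  "arg_T_s \<alpha> \<tau> \<xi> = arg_sin_pi \<xi> (\<tau> - \<alpha>) - arg_sin_pi \<xi> (\<tau> - 2 * \<alpha>)"

definition arg_T_B :: "real \<Rightarrow> real \<Rightarrow> real \<Rightarrow> real" where
  "arg_T_B \<alpha> \<tau> \<xi> = arg_Gamma \<xi> (1 + \<tau> - 2 * \<alpha>) - arg_Gamma \<xi> (1 + \<tau>)"

lemma is_Arg_T_s: "\<xi> \<noteq> 0 \<Longrightarrow> is_Arg (T_s \<alpha> \<tau> \<xi>) (arg_T_s \<alpha> \<tau> \<xi>)"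
  unfolding T_s_altdef arg_T_s_def by (intro is_Arg_divide is_Arg_sin_pi)

lemma T_B_conv_Gamma:
  "T_B \<alpha> \<tau> \<xi> = of_real (sin (pi * \<alpha>) / pi * Gamma (2 * \<alpha>)) *
     (Gamma (Complex (1 + \<tau> - 2 * \<alpha>) \<xi>) / Gamma (Complex (1 + \<tau>) \<xi>))"
proof -
  have "Complex (1 + \<tau> - 2 * \<alpha>) \<xi> + of_real (2 * \<alpha>) = Complex (1 + \<tau>) \<xi>"
    by (simp add: complex_eq_iff)
  thus ?thesis
    unfolding T_B_altdef Beta_def Gamma_complex_of_real by simp
qed

lemma is_Arg_T_B:
  assumes "\<xi> \<noteq> 0" "0 < \<alpha>" "\<alpha> < 1"
  shows "is_Arg (T_B \<alpha> \<tau> \<xi>) (arg_T_B \<alpha> \<tau> \<xi>)"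
proof -
  have "0 \<le> sin (pi * \<alpha>) / pi * Gamma (2 * \<alpha>)"
    using assms by (intro mult_nonneg_nonneg divide_nonneg_pos sin_ge_zero) auto
  hence "is_Arg (T_B \<alpha> \<tau> \<xi>) (0 + arg_T_B \<alpha> \<tau> \<xi>)"
    unfolding T_B_conv_Gamma arg_T_B_def
    using assms(1) by (intro is_Arg_mult is_Arg_divide is_Arg_of_real is_Arg_Gamma)
  thus ?thesis by simp
qed

lemma T_B_nonzero:
  assumes "\<xi> \<noteq> 0" "0 < \<alpha>" "\<alpha> < 1"
  shows "T_B \<alpha> \<tau> \<xi> \<noteq> 0"
proof -
  have "0 < sin (pi * \<alpha>)" "0 < Gamma (2 * \<alpha>)"
    using assms by (auto intro!: sin_gt_zero)
  hence "sin (pi * \<alpha>) / pi * Gamma (2 * \<alpha>) \<noteq> 0" by simp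
  thus ?thesis
    unfolding T_B_conv_Gamma mult_eq_0_iff divide_eq_0_iff of_real_eq_0_iff Gamma_eq_zero_iff
    using assms Complex_not_nonpos_Ints by blast
qed

lemma Im_T_s_neg:
  assumes "0 < \<xi>" "0 < \<alpha>" "\<alpha> < 1"
  shows "Im (T_s \<alpha> \<tau> \<xi>) < 0"
proof -
  let ?z = "of_real pi * Complex (\<tau> - \<alpha>) \<xi>" and ?w = "of_real pi * Complex (\<tau> - 2 * \<alpha>) \<xi>"
  have "Re ?z - Re ?w = pi * \<alpha>" by (simp add: algebra_simps)
  hence "0 < sin (Re ?z - Re ?w)"
    using assms by (simp add: sin_gt_zero)
  moreover have "0 < sinh (Im ?w)" using assms by simp
  moreover from this have "0 < cmod (sin ?w)" using abs_sinh_Im_le_cmod_sin[of ?w] by linarith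
  ultimately show ?thesis
    unfolding T_s_altdef by (subst Im_sin_divide_sin) (simp_all add: divide_neg_pos)
qed

lemma arg_T_s_gt_minus_pi:
  assumes "0 < \<xi>" "0 < \<alpha>" "\<alpha> < 1"
  shows "- pi < arg_T_s \<alpha> \<tau> \<xi>"
proof (rule ccontr)
  assume "\<not> - pi < arg_T_s \<alpha> \<tau> \<xi>"
  define f where "f a = arg_T_s a (\<tau> - \<alpha> + a) \<xi>" for a
  have "f 0 = 0" by (simp add: f_def arg_T_s_def)
  have "continuous_on {0..\<alpha>} f"
    unfolding f_def arg_T_s_def arg_sin_pi_def using assms
    by (intro continuous_intros continuous_on_compose2[OF continuous_on_arg_Gamma[of \<xi> UNIV]]) auto
  then obtain a where a: "0 \<le> a" "a \<le> \<alpha>" "f a = - pi"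
    using IVT2'[of f \<alpha> "- pi" 0] \<open>f 0 = 0\<close> \<open>\<not> - pi < arg_T_s \<alpha> \<tau> \<xi>\<close> assms by (auto simp: f_def)
  have "a \<noteq> 0" using a \<open>f 0 = 0\<close> by auto
  have "is_Arg (T_s a (\<tau> - \<alpha> + a) \<xi>) (- pi)"
    using is_Arg_T_s[of \<xi> a] assms a by (simp add: f_def flip: a(3))
  hence "Im (T_s a (\<tau> - \<alpha> + a) \<xi>) = 0" by (simp add: is_Arg_imp_Im_eq)
  moreover have "Im (T_s a (\<tau> - \<alpha> + a) \<xi>) < 0"
    using a \<open>a \<noteq> 0\<close> assms by (intro Im_T_s_neg) auto
  ultimately show False by simp
qed

lemma arg_T_B_neg:
  assumes "0 < \<xi>" "0 < \<alpha>"
  shows "arg_T_B \<alpha> \<tau> \<xi> < 0"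
proof -
  have "arg_Gamma \<xi> (1 + \<tau> - 2 * \<alpha>) < arg_Gamma \<xi> (1 + \<tau>)"
  proof (rule DERIV_pos_imp_increasing[where f = "arg_Gamma \<xi>"])
    fix t
    show "\<exists>d. (arg_Gamma \<xi> has_real_derivative d) (at t) \<and> 0 < d"
      using has_field_derivative_arg_Gamma[of \<xi> t] Im_Digamma_pos[of \<xi> t] assms by auto
  qed (use assms in simp)
  thus ?thesis by (simp add: arg_T_B_def)
qed

lemma has_field_derivative_arg_T_s_minus_arg_T_B:
  assumes "\<xi> \<noteq> 0"
  shows "((\<lambda>a. arg_T_s a (u + a) \<xi> - arg_T_B a (u + a) \<xi>) has_field_derivative
           (Im_Digamma \<xi> (1 + u + a) - Im_Digamma \<xi> (a - u))) (at a)"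
proof -
  note deriv = has_field_derivative_arg_Gamma[OF assms, THEN DERIV_chain2]
  have "((\<lambda>a. arg_T_s a (u + a) \<xi> - arg_T_B a (u + a) \<xi>) has_field_derivative
          (- Im_Digamma \<xi> (1 + (a - u)) - Im_Digamma \<xi> (u - a)
           + Im_Digamma \<xi> (1 + (u - a)) + Im_Digamma \<xi> (1 + u + a))) (at a)"
    unfolding arg_T_s_def arg_T_B_def arg_sin_pi_def
    by (auto intro!: derivative_eq_intros deriv simp: algebra_simps)
  moreover have "Im_Digamma \<xi> (u - a) = \<xi> / ((u - a)\<^sup>2 + \<xi>\<^sup>2) + Im_Digamma \<xi> (1 + (u - a))"
    using Im_Digamma_plus1[OF assms, of "u - a"] by (simp add: add.commute)
  moreover have "Im_Digamma \<xi> (a - u) = \<xi> / ((u - a)\<^sup>2 + \<xi>\<^sup>2) + Im_Digamma \<xi> (1 + (a - u))"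
    using Im_Digamma_plus1[OF assms, of "a - u"] by (simp add: add.commute power2_commute)
  ultimately show ?thesis by (simp add: algebra_simps)
qed

lemma arg_T_s_less_arg_T_B:
  assumes "0 < \<xi>" "0 < \<alpha>" "\<alpha> - 1/2 < \<tau>"
  shows "arg_T_s \<alpha> \<tau> \<xi> < arg_T_B \<alpha> \<tau> \<xi>"
proof -
  define u where "u = \<tau> - \<alpha>"
  define D where "D a = arg_T_s a (u + a) \<xi> - arg_T_B a (u + a) \<xi>" for a
  have deriv: "(D has_field_derivative (Im_Digamma \<xi> (1 + u + a) - Im_Digamma \<xi> (a - u))) (at a)" for a
    unfolding D_def using assms by (intro has_field_derivative_arg_T_s_minus_arg_T_B) simp
  have "D \<alpha> < D 0"
  proof (rule DERIV_neg_imp_decreasing_open[OF \<open>0 < \<alpha>\<close>])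
    fix a assume "0 < a" "a < \<alpha>"
    hence "Im_Digamma \<xi> (1 + u + a) < Im_Digamma \<xi> (a - u)"
      using assms by (intro Im_Digamma_less) (auto simp: u_def)
    with deriv[of a] show "\<exists>d. (D has_real_derivative d) (at a) \<and> d < 0" by force
  next
    show "continuous_on {0..\<alpha>} D"
      using deriv by (meson DERIV_isCont continuous_at_imp_continuous_on)
  qed
  thus ?thesis by (simp add: D_def u_def arg_T_s_def arg_T_B_def)
qed

lemma Arg_T_s_less_Arg_T_B:
  assumes "0 < \<alpha>" "\<alpha> < 1/2" "0 < \<tau>" "0 < \<xi>"
  shows "Arg (T_s \<alpha> \<tau> \<xi>) < Arg (T_B \<alpha> \<tau> \<xi>)"
proof -
  have bounds: "- pi < arg_T_s \<alpha> \<tau> \<xi>" "arg_T_s \<alpha> \<tau> \<xi> < arg_T_B \<alpha> \<tau> \<xi>" "arg_T_B \<alpha> \<tau> \<xi> < 0"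
    using assms by (auto intro!: arg_T_s_gt_minus_pi arg_T_s_less_arg_T_B arg_T_B_neg)
  have "T_s \<alpha> \<tau> \<xi> \<noteq> 0" using Im_T_s_neg[of \<xi> \<alpha> \<tau>] assms by auto
  hence "Arg (T_s \<alpha> \<tau> \<xi>) = arg_T_s \<alpha> \<tau> \<xi>"
    using assms bounds pi_gt_zero by (intro is_Arg_imp_Arg_eq is_Arg_T_s) linarith+
  moreover have "Arg (T_B \<alpha> \<tau> \<xi>) = arg_T_B \<alpha> \<tau> \<xi>"
    using assms bounds pi_gt_zero by (intro is_Arg_imp_Arg_eq is_Arg_T_B T_B_nonzero) linarith+
  ultimately show ?thesis using bounds by simp
qed

section \<open>Values on the real axis\<close>

definition T_s_real :: "real \<Rightarrow> real \<Rightarrow> real" where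
  "T_s_real \<alpha> \<tau> = sin (pi * (\<tau> - \<alpha>)) / sin (pi * (\<tau> - 2 * \<alpha>))"

definition T_B_real :: "real \<Rightarrow> real \<Rightarrow> real" where
  "T_B_real \<alpha> \<tau> = sin (pi * \<alpha>) / pi * Beta (1 + \<tau> - 2 * \<alpha>) (2 * \<alpha>)"

lemma T_s_zero: "T_s \<alpha> \<tau> 0 = of_real (T_s_real \<alpha> \<tau>)"
proof -
  have "of_real pi * Complex t 0 = of_real (pi * t)" for t by (simp add: complex_eq_iff)
  thus ?thesis by (simp only: T_s_altdef T_s_real_def sin_of_real of_real_divide)
qed

lemma T_B_zero: "T_B \<alpha> \<tau> 0 = of_real (T_B_real \<alpha> \<tau>)"
proof -
  have "Complex t 0 = of_real t" for t by (simp add: complex_eq_iff)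
  thus ?thesis
    unfolding T_B_altdef T_B_real_def by (simp only: Beta_complex_of_real flip: of_real_mult)
qed

lemma T_B_real_pos:
  assumes "0 < \<alpha>" "\<alpha> < 1" "2 * \<alpha> < 1 + \<tau>"
  shows "0 < T_B_real \<alpha> \<tau>"
  unfolding T_B_real_def using assms
  by (intro mult_pos_pos divide_pos_pos sin_gt_zero Beta_real_pos) auto

lemma T_B_real_antimono:
  assumes "0 < \<alpha>" "\<alpha> < 1" "2 * \<alpha> < 1 + \<sigma>" "\<sigma> \<le> \<tau>"
  shows "T_B_real \<alpha> \<tau> \<le> T_B_real \<alpha> \<sigma>"
  unfolding T_B_real_def using assms
  by (intro mult_left_mono Beta_real_mono divide_nonneg_pos sin_ge_zero) auto

text \<open>As \<open>\<tau>\<close> tends to \<open>0\<close>, both sides tend to \<open>1 / (2 cos (\<pi> \<alpha>))\<close>.\<close>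

lemma T_s_real_less_T_B_real:
  assumes "0 < \<tau>" "\<tau> < \<alpha>" "\<alpha> < 1/2"
  shows "T_s_real \<alpha> \<tau> < T_B_real \<alpha> \<tau>"
proof -
  have "T_s_real \<alpha> \<tau> = (sin (pi * (\<alpha> - \<tau>)) / pi) / (sin (pi * (2 * \<alpha> - \<tau>)) / pi)"
    using sin_minus[of "pi * (\<alpha> - \<tau>)"] sin_minus[of "pi * (2 * \<alpha> - \<tau>)"]
    by (simp add: T_s_real_def algebra_simps)
  also have "\<dots> = Gamma (\<alpha> - \<tau> + \<alpha>) / Gamma (\<alpha> - \<tau>) * (Gamma (1 - \<alpha> + \<tau> + \<alpha>) / Gamma (1 - \<alpha> + \<tau>))
                   * (Gamma (1 + \<tau> - 2 * \<alpha>) / Gamma (1 + \<tau>))"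
    using assms Gamma_real_neq_0[of "1 + \<tau>"]
    unfolding sin_pi_div_pi_conv_Gamma by (simp add: algebra_simps)
  also have "\<dots> < Gamma (\<alpha> + \<alpha>) / Gamma \<alpha> * (Gamma (1 - \<alpha> + \<alpha>) / Gamma (1 - \<alpha>))
                   * (Gamma (1 + \<tau> - 2 * \<alpha>) / Gamma (1 + \<tau>))"
    using assms
    by (intro mult_strict_right_mono Gamma_shift_quotients_spread_less divide_pos_pos Gamma_real_pos) auto
  also have "\<dots> = T_B_real \<alpha> \<tau>"
    unfolding T_B_real_def sin_pi_div_pi_conv_Gamma Beta_def by simp
  finally show ?thesis .
qed

text \<open>This includes the pole \<open>\<tau> = 2\<alpha>\<close> of \<open>T_s\<close>, where division by zero gives \<open>0\<close>.\<close>

lemma T_s_real_nonpos: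
  assumes "0 \<le> \<alpha>" "\<alpha> \<le> \<tau>" "\<tau> \<le> 2 * \<alpha>" "\<alpha> \<le> 1"
  shows "T_s_real \<alpha> \<tau> \<le> 0"
proof -
  have "0 \<le> sin (pi * (\<tau> - \<alpha>))" "0 \<le> sin (pi * (2 * \<alpha> - \<tau>))"
    using assms by (auto intro!: sin_ge_zero)
  moreover have "sin (pi * (\<tau> - 2 * \<alpha>)) = - sin (pi * (2 * \<alpha> - \<tau>))"
    by (simp add: algebra_simps flip: sin_minus)
  ultimately show ?thesis by (simp add: T_s_real_def)
qed

lemma T_s_real_gt_half:
  assumes "0 < \<alpha>" "2 * \<alpha> < \<tau>" "\<tau> < 1"
  shows "1 / 2 < T_s_real \<alpha> \<tau>"
proof -
  have pos: "0 < sin (pi * (\<tau> - \<alpha>))" "0 < sin (pi * (\<tau> - 2 * \<alpha>))" "0 < sin (pi * \<tau>)"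
    using assms by (auto intro!: sin_gt_zero)
  have "sin (pi * (\<tau> - 2 * \<alpha>)) + sin (pi * \<tau>) = 2 * sin (pi * (\<tau> - \<alpha>)) * cos (pi * \<alpha>)"
    using sin_add[of "pi * (\<tau> - \<alpha>)" "pi * \<alpha>"] sin_diff[of "pi * (\<tau> - \<alpha>)" "pi * \<alpha>"]
    by (simp add: algebra_simps)
  also have "\<dots> \<le> 2 * sin (pi * (\<tau> - \<alpha>))"
    using pos by (simp add: mult_le_cancel_left1)
  finally show ?thesis
    using pos by (simp add: T_s_real_def field_simps)
qed

lemma T_B_real_le_half:
  assumes "0 < \<alpha>" "\<alpha> < 1" "2 * \<alpha> \<le> \<tau>"
  shows "T_B_real \<alpha> \<tau> \<le> 1 / 2"
proof -
  have "T_B_real \<alpha> \<tau> \<le> T_B_real \<alpha> (2 * \<alpha>)"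
    using assms by (intro T_B_real_antimono) auto
  also have "\<dots> = sin (pi * \<alpha>) / (2 * (pi * \<alpha>))"
    using assms by (simp add: T_B_real_def Beta_1_left)
  also have "\<dots> \<le> 1 / 2"
    using sin_x_le_x[of "pi * \<alpha>"] assms by (simp add: field_simps)
  finally show ?thesis .
qed

lemma T_s_zero_neq_T_B_zero:
  assumes "0 < \<alpha>" "\<alpha> < 1/2" "0 < \<tau>" "\<tau> < 1"
  shows "T_s \<alpha> \<tau> 0 \<noteq> T_B \<alpha> \<tau> 0"
proof -
  consider (below) "\<tau> < \<alpha>" | (between) "\<alpha> \<le> \<tau>" "\<tau> \<le> 2 * \<alpha>" | (above) "2 * \<alpha> < \<tau>" by linarith
  hence "T_s_real \<alpha> \<tau> \<noteq> T_B_real \<alpha> \<tau>"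
  proof cases
    case below
    thus ?thesis using T_s_real_less_T_B_real[of \<tau> \<alpha>] assms by simp
  next
    case between
    thus ?thesis using T_s_real_nonpos[of \<alpha> \<tau>] T_B_real_pos[of \<alpha> \<tau>] assms by simp
  next
    case above
    thus ?thesis using T_s_real_gt_half[of \<alpha> \<tau>] T_B_real_le_half[of \<alpha> \<tau>] assms by simp
  qed
  thus ?thesis by (simp add: T_s_zero T_B_zero)
qed

section \<open>Comparison of moduli\<close>

lemma cmod_T_s_ge_tanh: "tanh (pi * \<xi>) \<le> cmod (T_s \<alpha> \<tau> \<xi>)"
proof -
  let ?z = "of_real pi * Complex (\<tau> - \<alpha>) \<xi>" and ?w = "of_real pi * Complex (\<tau> - 2 * \<alpha>) \<xi>"
  have "\<bar>tanh (Im ?w)\<bar> \<le> cmod (sin ?z / sin ?w)"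
    by (intro abs_tanh_le_cmod_sin_divide_sin) simp
  thus ?thesis by (simp add: T_s_altdef)
qed

lemma cmod_T_B_le_T_B_real:
  assumes "0 < \<alpha>" "\<alpha> < 1" "2 * \<alpha> < 1 + \<tau>"
  shows "cmod (T_B \<alpha> \<tau> \<xi>) \<le> T_B_real \<alpha> \<tau>"
proof -
  have "0 \<le> sin (pi * \<alpha>) / pi"
    using assms by (intro divide_nonneg_pos sin_ge_zero) auto
  moreover have "cmod (Beta (Complex (1 + \<tau> - 2 * \<alpha>) \<xi>) (of_real (2 * \<alpha>)))
          \<le> Beta (1 + \<tau> - 2 * \<alpha>) (2 * \<alpha>)"
    using cmod_Beta_le[of "Complex (1 + \<tau> - 2 * \<alpha>) \<xi>" "2 * \<alpha>"] assms by simp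
  ultimately show ?thesis
    unfolding T_B_altdef T_B_real_def norm_mult norm_of_real
    by (simp only: abs_of_nonneg mult_left_mono)
qed

lemma T_B_real_diagonal:
  assumes "0 < \<alpha>" "\<alpha> < 1"
  shows "T_B_real \<alpha> \<alpha> = Gamma (1 + 2 * \<alpha>) / (Gamma (1 + \<alpha>))\<^sup>2 / 2"
proof -
  have "T_B_real \<alpha> \<alpha> = 1 / (Gamma \<alpha> * Gamma (1 - \<alpha>)) *
          (Gamma (1 - \<alpha>) * Gamma (2 * \<alpha>) / Gamma (1 + \<alpha>))"
    unfolding T_B_real_def sin_pi_div_pi_conv_Gamma Beta_def by (simp add: add.commute[of 1])
  also have "\<dots> = Gamma (2 * \<alpha>) / (Gamma \<alpha> * Gamma (1 + \<alpha>))"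
    using assms Gamma_real_neq_0[of "1 - \<alpha>"] by simp
  also have "\<dots> = Gamma (1 + 2 * \<alpha>) / (Gamma (1 + \<alpha>))\<^sup>2 / 2"
    using assms by (simp add: Gamma_plus1_pos power2_eq_square)
  finally show ?thesis .
qed

lemma T_B_real_le_two_over_pi:
  assumes "0 < \<alpha>" "\<alpha> \<le> 1/2" "\<alpha> \<le> \<tau>"
  shows "T_B_real \<alpha> \<tau> \<le> 2 / pi"
proof -
  have "T_B_real \<alpha> \<tau> \<le> T_B_real \<alpha> \<alpha>"
    using assms by (intro T_B_real_antimono) auto
  also have "\<dots> = Gamma (1 + 2 * \<alpha>) / (Gamma (1 + \<alpha>))\<^sup>2 / 2"
    using assms by (intro T_B_real_diagonal) auto
  also have "\<dots> \<le> Gamma (1 + 2 * (1/2)) / (Gamma (1 + 1/2))\<^sup>2 / 2"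
    using assms by (intro divide_right_mono Gamma_double_quotient_mono) auto
  also have "\<dots> = T_B_real (1/2) (1/2)"
    by (rule T_B_real_diagonal[symmetric]) auto
  also have "\<dots> = 2 / pi"
    by (simp add: T_B_real_def Beta_commute[of "1/2"] Beta_1_left)
  finally show ?thesis .
qed

lemma two_over_pi_less_tanh: "2 / pi < tanh (pi / 4)"
proof -
  have "(pi + 2) / (pi - 2) < (1 + 157/100 / 20) ^ 20"
    using pi_approx(1) by (simp add: field_simps)
  also have "\<dots> \<le> exp (157/100)"
    using exp_ge_one_plus_x_over_n_power_n[of 20 "157/100"] by simp
  also have "\<dots> \<le> exp (pi / 2)" using pi_approx(1) by simp
  finally have "(pi + 2) / (pi - 2) < exp (pi / 2)" .
  hence "2 * (exp (pi / 2) + 1) < (exp (pi / 2) - 1) * pi"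
    using pi_gt3 by (simp add: pos_divide_less_eq algebra_simps)
  moreover have "0 < exp (pi / 2) + 1" by (simp add: add_pos_pos)
  ultimately have "2 / pi < (exp (pi / 2) - 1) / (exp (pi / 2) + 1)"
    by (simp add: field_simps)
  also have "\<dots> = tanh (pi / 4)"
    using tanh_ln_real[of "exp (pi / 4)"] by (simp flip: exp_double)
  finally show ?thesis .
qed

lemma cmod_T_B_less_cmod_T_s:
  assumes "0 < \<alpha>" "\<alpha> < 1/2" "\<alpha> \<le> \<tau>" "1/4 \<le> \<xi>"
  shows "cmod (T_B \<alpha> \<tau> \<xi>) < cmod (T_s \<alpha> \<tau> \<xi>)"
proof -
  have "cmod (T_B \<alpha> \<tau> \<xi>) \<le> T_B_real \<alpha> \<tau>"
    using assms by (intro cmod_T_B_le_T_B_real) auto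
  also have "\<dots> \<le> 2 / pi"
    using assms by (intro T_B_real_le_two_over_pi) auto
  also note two_over_pi_less_tanh
  also have "tanh (pi / 4) \<le> tanh (pi * \<xi>)"
    using assms by simp
  also have "\<dots> \<le> cmod (T_s \<alpha> \<tau> \<xi>)"
    by (rule cmod_T_s_ge_tanh)
  finally show ?thesis .
qed

section \<open>Non-existence of solutions\<close>

lemma T_s_cnj: "T_s \<alpha> \<tau> (- \<xi>) = cnj (T_s \<alpha> \<tau> \<xi>)"
  by (simp add: T_s_def cnj_sin)

lemma T_B_cnj: "T_B \<alpha> \<tau> (- \<xi>) = cnj (T_B \<alpha> \<tau> \<xi>)"
  by (simp add: T_B_def Beta_def cnj_Gamma)

lemma T_s_neq_T_B:
  assumes "0 < \<alpha>" "\<alpha> < 1/2" "0 < \<tau>" "\<tau> < 1"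
  shows "T_s \<alpha> \<tau> \<xi> \<noteq> T_B \<alpha> \<tau> \<xi>"
proof -
  have pos: "T_s \<alpha> \<tau> \<eta> \<noteq> T_B \<alpha> \<tau> \<eta>" if "0 < \<eta>" for \<eta>
    using Arg_T_s_less_Arg_T_B[of \<alpha> \<tau> \<eta>] assms that by auto
  show ?thesis
  proof (cases \<xi> "0 :: real" rule: linorder_cases)
    case less
    thus ?thesis using pos[of "- \<xi>"] by (simp add: T_s_cnj T_B_cnj)
  next
    case equal
    thus ?thesis using T_s_zero_neq_T_B_zero assms by simp
  next
    case greater
    thus ?thesis by (rule pos)
  qed
qed

theorem theorem9p3:
  fixes \<alpha> :: real
  assumes "0 < \<alpha>" and "\<alpha> < 1/2"
  shows "(\<forall>\<tau>. 0 < \<tau> \<and> \<tau> < 1 \<longrightarrow> T_s \<alpha> \<tau> 0 \<noteq> T_B \<alpha> \<tau> 0)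
       \<and> (\<forall>\<tau> \<xi>. \<xi> \<ge> 1/4 \<and> \<alpha> \<le> \<tau> \<and> \<tau> < 1 \<longrightarrow> cmod (T_s \<alpha> \<tau> \<xi>) > cmod (T_B \<alpha> \<tau> \<xi>))
       \<and> (\<forall>\<tau> \<xi>. 0 < \<xi> \<and> \<xi> < 1/4 \<and> \<alpha> \<le> \<tau> \<and> \<tau> < 1 \<longrightarrow> Arg (T_s \<alpha> \<tau> \<xi>) < Arg (T_B \<alpha> \<tau> \<xi>))
       \<and> (\<forall>\<tau> \<xi>. 0 < \<xi> \<and> 0 < \<tau> \<and> \<tau> < \<alpha> \<longrightarrow> Arg (T_s \<alpha> \<tau> \<xi>) \<noteq> Arg (T_B \<alpha> \<tau> \<xi>))
       \<and> (\<forall>\<tau> \<xi>. 0 < \<tau> \<and> \<tau> < 1 \<longrightarrow> T_s \<alpha> \<tau> \<xi> \<noteq> T_B \<alpha> \<tau> \<xi>)"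
proof (intro conjI allI impI)
  fix \<tau> \<xi> :: real
  show "T_s \<alpha> \<tau> 0 \<noteq> T_B \<alpha> \<tau> 0" if "0 < \<tau> \<and> \<tau> < 1"
    using that assms by (intro T_s_zero_neq_T_B_zero) auto
  show "cmod (T_s \<alpha> \<tau> \<xi>) > cmod (T_B \<alpha> \<tau> \<xi>)" if "\<xi> \<ge> 1/4 \<and> \<alpha> \<le> \<tau> \<and> \<tau> < 1"
    using that assms by (intro cmod_T_B_less_cmod_T_s) auto
  show "Arg (T_s \<alpha> \<tau> \<xi>) < Arg (T_B \<alpha> \<tau> \<xi>)" if "0 < \<xi> \<and> \<xi> < 1/4 \<and> \<alpha> \<le> \<tau> \<and> \<tau> < 1"
    using that assms by (intro Arg_T_s_less_Arg_T_B) auto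
  show "Arg (T_s \<alpha> \<tau> \<xi>) \<noteq> Arg (T_B \<alpha> \<tau> \<xi>)" if "0 < \<xi> \<and> 0 < \<tau> \<and> \<tau> < \<alpha>"
    using that assms Arg_T_s_less_Arg_T_B[of \<alpha> \<tau> \<xi>] by auto
  show "T_s \<alpha> \<tau> \<xi> \<noteq> T_B \<alpha> \<tau> \<xi>" if "0 < \<tau> \<and> \<tau> < 1"
    using that assms by (intro T_s_neq_T_B) auto
qed

end
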